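(* Let $(X,\preceq)$ be a Riesz space and $K$ a convex complete sublattice of $X$. Let $m\ge1$ be an integer, let $\lambda_1>0$ and $\lambda_k\ge 0$ for $2\le k\le m$ be real numbers, and let $F\in\mathcal{F}_{op}(K)$. Consider the equation $$\lambda_1 f+\lambda_2 f^2+\cdots+\lambda_m f^m=F \quad\text{on } K. \qquad ( * )$$ (i) If $f,g\in\mathcal{F}_{op}(K)$ are solutions of $( * )$ such that $f\trianglelefteq g$, then $f=g$ on $K$. (ii) If $f,g\in\mathcal{F}_{op}(K)$ are solutions of $( * )$ such that $f$ subcommutes with $g$ and $f(x)\prec g(x)$ for some $x\in K$, then $f=g$ on $K$. (iii) If $K$ is a chain in the order $\preceq$, and $f,g\in\mathcal{F}_{op}(K)$ are solutions of $( * )$ such that $f\circ g=g\circ f$, then $f=g$ on $K$.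
   Context: A Riesz space is a real vector space $X$ with a partial order $\preceq$ that is a lattice and satisfies: $x\preceq y$ implies $x+z\preceq y+z$ for all $z\in X$; and $0\preceq x$ implies $0\preceq \alpha x$ for all real $\alpha\ge 0$. A lattice is complete if each of its nonempty subsets has a supremum and an infimum in it. A nonempty subset $E$ of a lattice $X$ is a complete sublattice of $X$ if it is a complete lattice with respect to the order inherited from $X$. A subset $E$ is convex if $\{z\in X: x\preceq z\preceq y\}\subseteq E$ whenever $x\preceq y$ in $E$. A convex complete sublattice is a complete sublattice that is convex. $\mathcal{F}_{op}(K)$ denotes the set of all order-preserving self-maps $f:K\to K$ (i.e. $x\preceq y$ implies $f(x)\preceq f(y)$), ordered by $f\trianglelefteq g$ iff $f(x)\preceq g(x)$ for all $x\in K$. $f$ subcommutes with $g$ if $f\circ g\trianglelefteq g\circ f$. $x\prec y$ means $x\preceq y$ and $x\ne y$. $K$ is a chain if for all $x,y\in K$ at least one of $x\preceq y$, $y\preceq x$ holds. $f^k$ denotes the $k$-th iterate of $f$; sums and scalar multiples of maps are pointwise in $X$. *)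

theory Defs
  imports Complex_Main "HOL-Library.Lub_Glb"
begin

(* A Riesz space is a type of sort {ordered_real_vector, lattice}: over an ordered abelian group
   each of the two axioms of ordered_real_vector is equivalent to: a >= 0 and x >= 0 imply
   a *R x >= 0. *)

(* Suprema and infima are taken within E, i.e. for the inherited order: isLub E A s says that s
   is the least element among the upper bounds of A that lie in E. *)
definition complete_sublattice :: "'a::lattice set \<Rightarrow> bool" where
  "complete_sublattice E \<longleftrightarrow>
     E \<noteq> {} \<and> (\<forall>A\<subseteq>E. A \<noteq> {} \<longrightarrow> (\<exists>s. isLub E A s) \<and> (\<exists>i. isGlb E A i))"

(* Convexity with respect to the order, not the linear notion of the constant convex. *)
definition order_convex :: "'a::order set \<Rightarrow> bool" where
  "order_convex E \<longleftrightarrow> (\<forall>x\<in>E. \<forall>y\<in>E. x \<le> y \<longrightarrow> {x..y} \<subseteq> E)"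

definition convex_complete_sublattice :: "'a::lattice set \<Rightarrow> bool" where
  "convex_complete_sublattice E \<longleftrightarrow> complete_sublattice E \<and> order_convex E"

(* Self-maps of K are total functions on the whole type that map K into K. Their values outside K
   are arbitrary, so all relations between maps below are restricted to points of K. *)
definition F_op :: "'a::order set \<Rightarrow> ('a \<Rightarrow> 'a) set" where
  "F_op K = {f. f ` K \<subseteq> K \<and> mono_on K f}"

definition le_map_on :: "'a::order set \<Rightarrow> ('a \<Rightarrow> 'a) \<Rightarrow> ('a \<Rightarrow> 'a) \<Rightarrow> bool" where
  "le_map_on K f g \<longleftrightarrow> (\<forall>x\<in>K. f x \<le> g x)"

definition eq_map_on :: "'a set \<Rightarrow> ('a \<Rightarrow> 'a) \<Rightarrow> ('a \<Rightarrow> 'a) \<Rightarrow> bool" where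
  "eq_map_on K f g \<longleftrightarrow> (\<forall>x\<in>K. f x = g x)"

definition subcommutes_on :: "'a::order set \<Rightarrow> ('a \<Rightarrow> 'a) \<Rightarrow> ('a \<Rightarrow> 'a) \<Rightarrow> bool" where
  "subcommutes_on K f g \<longleftrightarrow> le_map_on K (f \<circ> g) (g \<circ> f)"

definition iterative_solution ::
  "'a::ordered_real_vector set \<Rightarrow> nat \<Rightarrow> (nat \<Rightarrow> real) \<Rightarrow> ('a \<Rightarrow> 'a) \<Rightarrow> ('a \<Rightarrow> 'a) \<Rightarrow> bool" where
  "iterative_solution K m lam F f \<longleftrightarrow>
     f \<in> F_op K \<and> eq_map_on K (\<lambda>x. \<Sum>k=1..m. lam k *\<^sub>R (f ^^ k) x) F"

end

(* Two solutions f, g with f^k(x) \<le> g^k(x) for all k agree at x: the nonnegative combinations of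
   iterates have the same value F(x), so they agree termwise, and the coefficient of the first
   iterate is positive. The iterates are comparable at x if f \<le> g on K. They are also comparable if
   f subcommutes with g and merely f(x) \<le> g(x), because
   f^(k+1)(x) \<le> f(g^k(x)) \<le> g^k(f(x)) \<le> g^(k+1)(x).
   Hence the strict inequality in (ii) is contradictory, and in a chain f(x) and g(x) are always
   comparable. *)
theory Submission
  imports Defs
begin

lemma F_op_closed: "f \<in> F_op K \<Longrightarrow> x \<in> K \<Longrightarrow> f x \<in> K"
  by (auto simp: F_op_def)

lemma F_op_mono: "f \<in> F_op K \<Longrightarrow> x \<in> K \<Longrightarrow> y \<in> K \<Longrightarrow> x \<le> y \<Longrightarrow> f x \<le> f y"
  by (auto simp: F_op_def mono_on_def)

lemma funpow_F_op:
  assumes "f \<in> F_op K"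
  shows "f ^^ k \<in> F_op K"
  using assms by (induction k) (fastforce simp: F_op_def mono_on_def image_subset_iff)+

text \<open>Induction on k: the order of the maps is applied at the moving point
  \<open>(g ^^ k) x\<close>, which is why the comparison is assumed on all of K.\<close>

lemma funpow_le_of_le_map_on:
  assumes f: "f \<in> F_op K" and g: "g \<in> F_op K" and le: "le_map_on K f g" and x: "x \<in> K"
  shows "(f ^^ k) x \<le> (g ^^ k) x"
proof (induction k)
  case (Suc k)
  have fk: "(f ^^ k) x \<in> K" and gk: "(g ^^ k) x \<in> K"
    using f g x by (auto intro: F_op_closed funpow_F_op)
  have "f ((f ^^ k) x) \<le> f ((g ^^ k) x)"
    using f fk gk Suc.IH by (rule F_op_mono)
  also have "\<dots> \<le> g ((g ^^ k) x)"
    using le gk by (simp add: le_map_on_def)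
  finally show ?case by simp
qed simp

text \<open>Induction moves f inward past the copies of g: past the outermost one by subcommutation
  at \<open>(g ^^ k) x\<close>, past the others by applying the monotone g to the induction
  hypothesis.\<close>

lemma subcommutes_on_funpow:
  assumes f: "f \<in> F_op K" and g: "g \<in> F_op K" and sub: "subcommutes_on K f g"
  shows "subcommutes_on K f (g ^^ k)"
proof (induction k)
  case (Suc k)
  have "f (g ((g ^^ k) x)) \<le> g ((g ^^ k) (f x))" if x: "x \<in> K" for x
  proof -
    have gk: "(g ^^ k) x \<in> K" and gkf: "(g ^^ k) (f x) \<in> K"
      using f g x by (auto intro: F_op_closed funpow_F_op)
    have "f (g ((g ^^ k) x)) \<le> g (f ((g ^^ k) x))"
      using sub gk by (simp add: subcommutes_on_def le_map_on_def)
    also have "\<dots> \<le> g ((g ^^ k) (f x))"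
      using g F_op_closed[OF f gk] gkf
    proof (rule F_op_mono)
      show "f ((g ^^ k) x) \<le> (g ^^ k) (f x)"
        using Suc.IH x by (simp add: subcommutes_on_def le_map_on_def)
    qed
    finally show ?thesis .
  qed
  then show ?case by (simp add: subcommutes_on_def le_map_on_def)
qed (simp add: subcommutes_on_def le_map_on_def)

lemma funpow_le_of_subcommutes_on:
  assumes f: "f \<in> F_op K" and g: "g \<in> F_op K" and sub: "subcommutes_on K f g"
    and x: "x \<in> K" and le: "f x \<le> g x"
  shows "(f ^^ k) x \<le> (g ^^ k) x"
proof (induction k)
  case (Suc k)
  have fk: "(f ^^ k) x \<in> K" and gk: "(g ^^ k) x \<in> K"
    using f g x by (auto intro: F_op_closed funpow_F_op)
  have "f ((f ^^ k) x) \<le> f ((g ^^ k) x)"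
    using f fk gk Suc.IH by (rule F_op_mono)
  \<comment> \<open>Now f acts on x itself, the only point where f and g are known to be
    comparable.\<close>
  also have "\<dots> \<le> (g ^^ k) (f x)"
    using subcommutes_on_funpow[OF f g sub, of k] x by (simp add: subcommutes_on_def le_map_on_def)
  also have "\<dots> \<le> (g ^^ k) (g x)"
    using funpow_F_op[OF g] F_op_closed[OF f x] F_op_closed[OF g x] le by (rule F_op_mono)
  finally show ?case by (simp add: funpow_swap1)
qed simp

lemma iterative_solutions_eq_at:
  assumes "m \<ge> 1" and lam1: "lam 1 > 0" and lam: "\<forall>k\<in>{2..m}. lam k \<ge> 0"
    and f: "iterative_solution K m lam F f" and g: "iterative_solution K m lam F g"
    and x: "x \<in> K" and le: "\<And>k. (f ^^ k) x \<le> (g ^^ k) x"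
  shows "f x = g x"
proof -
  have nonneg: "lam k \<ge> 0" if "k \<in> {1..m}" for k
    using that lam lam1 by (cases "k = 1") auto
  have "(\<Sum>k=1..m. lam k *\<^sub>R ((g ^^ k) x - (f ^^ k) x)) = 0"
    using f g x
    by (simp add: iterative_solution_def eq_map_on_def scaleR_diff_right sum_subtractf)
  moreover have "lam k *\<^sub>R ((g ^^ k) x - (f ^^ k) x) \<ge> 0" if "k \<in> {1..m}" for k
    using nonneg[OF that] le[of k] by (simp add: scaleR_nonneg_nonneg)
  \<comment> \<open>Although the order is only partial, a finite sum of nonnegative elements
    vanishes only if every term does.\<close>
  ultimately have "\<forall>k\<in>{1..m}. lam k *\<^sub>R ((g ^^ k) x - (f ^^ k) x) = 0"
    by (subst (asm) sum_nonneg_eq_0_iff) auto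
  then have "lam 1 *\<^sub>R ((g ^^ 1) x - (f ^^ 1) x) = 0"
    using \<open>m \<ge> 1\<close> by fastforce
  then show ?thesis using lam1 by simp
qed

theorem theorem3:
  fixes K :: "'a::{ordered_real_vector, lattice} set"
    and m :: nat
    and lam :: "nat \<Rightarrow> real"
    and F :: "'a \<Rightarrow> 'a"
  assumes "convex_complete_sublattice K"
    and "m \<ge> 1"
    and "lam 1 > 0"
    and "\<forall>k\<in>{2..m}. lam k \<ge> 0"
    and "F \<in> F_op K"
  shows
    "(\<forall>f g. iterative_solution K m lam F f \<and> iterative_solution K m lam F g \<and>
        le_map_on K f g \<longrightarrow> eq_map_on K f g)
     \<and>
     (\<forall>f g. iterative_solution K m lam F f \<and> iterative_solution K m lam F g \<and>
        subcommutes_on K f g \<and> (\<exists>x\<in>K. f x < g x) \<longrightarrow> eq_map_on K f g)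
     \<and>
     (Complete_Partial_Order.chain (\<le>) K \<longrightarrow>
        (\<forall>f g. iterative_solution K m lam F f \<and> iterative_solution K m lam F g \<and>
           eq_map_on K (f \<circ> g) (g \<circ> f) \<longrightarrow> eq_map_on K f g))"
proof (intro conjI allI impI; (elim conjE)?)
  note eq_at = iterative_solutions_eq_at[OF assms(2-4)]
  fix f g
  assume sol: "iterative_solution K m lam F f" "iterative_solution K m lam F g"
  then have op: "f \<in> F_op K" "g \<in> F_op K"
    by (simp_all add: iterative_solution_def)
  {
    assume "le_map_on K f g"
    with op sol show "eq_map_on K f g"
      unfolding eq_map_on_def by (blast intro: eq_at funpow_le_of_le_map_on)
  next
    assume "subcommutes_on K f g" and "\<exists>x\<in>K. f x < g x"
    then obtain x where x: "x \<in> K" "f x < g x" by blast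
    have "f x = g x"
      using sol x(1) funpow_le_of_subcommutes_on[OF op \<open>subcommutes_on K f g\<close> x(1)] x(2)
      by (intro eq_at) auto
    \<comment> \<open>The equality contradicts \<open>f x < g x\<close>, so the claim on all of K
      holds vacuously.\<close>
    with x(2) show "eq_map_on K f g" by simp
  next
    assume chain: "Complete_Partial_Order.chain (\<le>) K" and "eq_map_on K (f \<circ> g) (g \<circ> f)"
    \<comment> \<open>Commuting maps subcommute in both orders, so either map may play the role of
      the smaller one.\<close>
    then have sub: "subcommutes_on K f g" "subcommutes_on K g f"
      by (simp_all add: eq_map_on_def subcommutes_on_def le_map_on_def)
    show "eq_map_on K f g"
      unfolding eq_map_on_def
    \<comment> \<open>Which of \<open>f x\<close> and \<open>g x\<close> is smaller may depend on x,
      so the cases are split at each point separately.\<close>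
    proof
      fix x assume x: "x \<in> K"
      then have "f x \<le> g x \<or> g x \<le> f x"
        using chainD[OF chain] op by (blast intro: F_op_closed)
      then show "f x = g x"
      proof
        assume "f x \<le> g x"
        with op sub(1) x show ?thesis
          by (intro eq_at[OF sol x] funpow_le_of_subcommutes_on)
      next
        assume "g x \<le> f x"
        with op sub(2) x have "g x = f x"
          by (intro eq_at[OF sol(2,1) x] funpow_le_of_subcommutes_on)
        then show ?thesis ..
      qed
    qed
  }
qed

end
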